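(* Let $M\in\mathbb{N}$, $M\ge 1$, be fixed. The numerical flow $\Psi_h^{[M]}$ of the adjoint ($q$-implicit) Symplectic Euler method with $M$ fixed point iterations for the Hamiltonian $H$ satisfies $$(D\Psi_h^{[M]})^TJ(D\Psi_h^{[M]})=\begin{pmatrix}O&I+\hat E\\-(I+\hat E)^T&\hat D\end{pmatrix}=J+\begin{pmatrix}O&\hat E\\-\hat E^T&\hat D\end{pmatrix},$$ where both $N\times N$ matrices $\hat D$ and $\hat E$ (depending on $h$ and $(q,p)$) are of order $\mathcal{O}(h^{M+1})$ as $h\to 0$.
   Context: Let $N\ge 1$, let $\mathcal{D}\subset\mathbb{R}^N\times\mathbb{R}^N$ be compact and convex, and let $H=H(q,p)$ be a real-valued Hamiltonian which is sufficiently smooth on $\mathcal{D}$ (all derivatives exist and are continuous; concretely, $H$ is $C^\infty$ on an open neighbourhood of $\mathcal{D}$). $H_q,H_p$ denote the gradients of $H$ with respect to $q$ and $p$. $J=\begin{pmatrix}O&I\\-I&O\end{pmatrix}\in\mathbb{R}^{2N\times 2N}$, with $I$ the $N\times N$ identity and $O$ the zero matrix. The adjoint ($q$-implicit) Symplectic Euler method with $M$ fixed point iterations and step $h>0$: given $(q,p)$, put $q_0:=q$, $q_{n+1}:=q+hH_p(q_n,p)$ for $n=0,\dots,M-1$, $\tilde q:=q_M$, $\tilde p:=p-hH_q(\tilde q,p)$; the numerical flow is $\Psi_h^{[M]}(q,p):=(\tilde q,\tilde p)$, and $D\Psi_h^{[M]}$ is its $2N\times 2N$ Jacobian matrix with respect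 to $(q,p)$. Standing assumption: $S\subset\mathcal{D}$ is a set of initial values and $h_0>0$ is such that for all $0<h\le h_0$ and $(q,p)\in S$ all points at which $H$ and its derivatives are evaluated in the scheme, and the result of the step, lie in $\mathcal{D}$. A matrix depending on $h$ and $(q,p)$ is $\mathcal{O}(h^r)$ if its norm is at most $Ch^r$ for all sufficiently small $h\in(0,h_0]$ and all $(q,p)\in S$, with $C$ independent of $h$ and $(q,p)$ (it may depend on $H,\mathcal{D},M,N$). *)

theory Defs
  imports "HOL-Analysis.Analysis"
begin

text \<open>
  For open \<open>U\<close>: all iterated partial derivatives up to order \<open>k\<close> exist and are continuous on \<open>U\<close>.
\<close>

primrec Ck_on :: "nat \<Rightarrow> 'a::euclidean_space set \<Rightarrow> ('a \<Rightarrow> real) \<Rightarrow> bool" where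
  "Ck_on 0 U f \<longleftrightarrow> continuous_on U f"
| "Ck_on (Suc k) U f \<longleftrightarrow>
     (\<forall>x\<in>U. f differentiable (at x)) \<and>
     (\<forall>b\<in>Basis. Ck_on k U (\<lambda>x. frechet_derivative f (at x) b))"

definition smooth_on :: "'a::euclidean_space set \<Rightarrow> ('a \<Rightarrow> real) \<Rightarrow> bool" where
  "smooth_on U f \<longleftrightarrow> (\<forall>k. Ck_on k U f)"

definition grad :: "('a::real_inner \<Rightarrow> real) \<Rightarrow> 'a \<Rightarrow> 'a" where
  "grad f x = (THE D. GDERIV f x :> D)"

lemma grad_eqI: "GDERIV f x :> D \<Longrightarrow> grad f x = D"
  unfolding grad_def
proof (rule the_equality)
  fix D' assume "GDERIV f x :> D" "GDERIV f x :> D'"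
  then have "(\<lambda>h. h \<bullet> D') = (\<lambda>h. h \<bullet> D)"
    unfolding gderiv_def by (rule has_derivative_unique[rotated])
  then show "D' = D"
    by (metis inner_eq_zero_iff inner_diff_right right_minus_eq)
qed

definition grad_q :: "((real^'n) \<times> (real^'n) \<Rightarrow> real) \<Rightarrow> (real^'n) \<times> (real^'n) \<Rightarrow> real^'n" where
  "grad_q H z = grad (\<lambda>q. H (q, snd z)) (fst z)"

definition grad_p :: "((real^'n) \<times> (real^'n) \<Rightarrow> real) \<Rightarrow> (real^'n) \<times> (real^'n) \<Rightarrow> real^'n" where
  "grad_p H z = grad (\<lambda>p. H (fst z, p)) (snd z)"

primrec fp_iter ::
  "((real^'n) \<times> (real^'n) \<Rightarrow> real) \<Rightarrow> real \<Rightarrow> real^'n \<Rightarrow> real^'n \<Rightarrow> nat \<Rightarrow> real^'n" where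
  "fp_iter H h q p 0 = q"
| "fp_iter H h q p (Suc n) = q + h *\<^sub>R grad_p H (fp_iter H h q p n, p)"

definition num_flow ::
  "((real^'n) \<times> (real^'n) \<Rightarrow> real) \<Rightarrow> nat \<Rightarrow> real \<Rightarrow>
   (real^'n) \<times> (real^'n) \<Rightarrow> (real^'n) \<times> (real^'n)" where
  "num_flow H M h z =
     (let q' = fp_iter H h (fst z) (snd z) M in (q', snd z - h *\<^sub>R grad_q H (q', snd z)))"

text \<open>
  One step evaluates derivatives of \<open>H\<close> at \<open>(q\<^sub>n, p)\<close>: with respect to \<open>p\<close> for \<open>n < M\<close>,
  with respect to \<open>q\<close> for \<open>n = M\<close>.
\<close>

definition admissible ::
  "((real^'n) \<times> (real^'n) \<Rightarrow> real) \<Rightarrow> ((real^'n) \<times> (real^'n)) set \<Rightarrow> nat \<Rightarrow>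
   ((real^'n) \<times> (real^'n)) set \<Rightarrow> real \<Rightarrow> bool" where
  "admissible H \<D> M S h0 \<longleftrightarrow>
     S \<subseteq> \<D> \<and> 0 < h0 \<and>
     (\<forall>h q p. 0 < h \<and> h \<le> h0 \<and> (q, p) \<in> S \<longrightarrow>
        (\<forall>n\<le>M. (fp_iter H h q p n, p) \<in> \<D>) \<and> num_flow H M h (q, p) \<in> \<D>)"

text \<open>
  Phase space coordinates: the \<open>2N\<close> components are indexed by the disjoint sum \<open>'n + 'n\<close>,
  with \<open>Inl\<close> for the components of \<open>q\<close> and \<open>Inr\<close> for those of \<open>p\<close>.
\<close>

definition pack :: "(real^'n) \<times> (real^'n) \<Rightarrow> real^('n + 'n)" where
  "pack z = (\<chi> i. case i of Inl a \<Rightarrow> fst z $ a | Inr a \<Rightarrow> snd z $ a)"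

definition unpack :: "real^('n + 'n) \<Rightarrow> (real^'n) \<times> (real^'n)" where
  "unpack v = ((\<chi> a. v $ Inl a), (\<chi> a. v $ Inr a))"

lemma unpack_pack [simp]: "unpack (pack z) = z"
  by (simp add: pack_def unpack_def)

lemma pack_unpack [simp]: "pack (unpack v) = v"
  by (simp add: pack_def unpack_def vec_eq_iff split: sum.split)

definition jacobian_at ::
  "((real^'n) \<times> (real^'n) \<Rightarrow> (real^'n) \<times> (real^'n)) \<Rightarrow> (real^'n) \<times> (real^'n) \<Rightarrow>
   real^('n + 'n)^('n + 'n)" where
  "jacobian_at \<Psi> z = jacobian (\<lambda>v. pack (\<Psi> (unpack v))) (at (pack z))"

definition block_mat ::
  "real^'n^'n \<Rightarrow> real^'n^'n \<Rightarrow> real^'n^'n \<Rightarrow> real^'n^'n \<Rightarrow> real^('n + 'n)^('n + 'n)" where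
  "block_mat A B C D = (\<chi> i j.
     case i of
       Inl a \<Rightarrow> (case j of Inl b \<Rightarrow> A $ a $ b | Inr b \<Rightarrow> B $ a $ b)
     | Inr a \<Rightarrow> (case j of Inl b \<Rightarrow> C $ a $ b | Inr b \<Rightarrow> D $ a $ b))"

definition J_mat :: "real^('n::finite + 'n)^('n + 'n)" where
  "J_mat = block_mat 0 (mat 1) (- mat 1) 0"

end

theory Submission
  imports Defs
begin

text \<open>
  Write \<open>q\<^sub>n\<close> for the fixed point iterates, \<open>T\<^sub>n w\<close> for the derivative of \<open>q\<^sub>n\<close> with respect to
  \<open>(q, p)\<close> in direction \<open>w = (w\<^sub>q, w\<^sub>p)\<close>, and \<open>A\<close> for the Hessian of \<open>H\<close>. Differentiating the
  iteration gives \<open>T\<^sub>n\<^sub>+\<^sub>1 w = w\<^sub>q + h (A(q\<^sub>n, p) (T\<^sub>n w, w\<^sub>p))\<^sub>p\<close>. If the iteration were stationary at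
  \<open>M\<close>, i.e. \<open>T\<^sub>M = T\<^sub>M\<^sub>+\<^sub>1\<close>, the step would be symplectic. In general, the symmetry of
  \<open>A\<close> alone yields the exact identity

    \<open>\<omega> (D\<Psi> v) (D\<Psi> w) = \<omega> v w + \<delta> v \<bullet> w\<^sub>p - v\<^sub>p \<bullet> \<delta> w\<close>, where \<open>\<delta> = T\<^sub>M - T\<^sub>M\<^sub>+\<^sub>1\<close>

  (\<open>symplectic_form_derivative_step\<close>). Evaluated on pairs of basis vectors this is the asserted block
  form: the \<open>qq\<close> block vanishes because both \<open>p\<close> components of the arguments do, \<open>E\<close> consists of the
  components of \<open>\<delta>\<close> on the \<open>q\<close> directions, and \<open>D\<close> is \<open>\<delta>\<close> on the \<open>p\<close> directions minus its transpose.

  It remains to see that \<open>\<delta> = O(h\<^sup>M\<^sup>+\<^sup>1)\<close>. Each iteration contracts differences by a factor \<open>O(h)\<close>: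
  first \<open>q\<^sub>n\<^sub>+\<^sub>1 - q\<^sub>n = O(h\<^sup>n\<^sup>+\<^sup>1)\<close>, because the gradient of \<open>H\<close> is Lipschitz on \<open>\<D>\<close>, and then
  \<open>T\<^sub>n\<^sub>+\<^sub>1 - T\<^sub>n = O(h\<^sup>n\<^sup>+\<^sup>1)\<close>, because the Hessian is bounded and Lipschitz on \<open>\<D>\<close>
  (\<open>tangent_iter_difference_bound\<close>). Compactness of \<open>\<D>\<close> bounds all derivatives of \<open>H\<close> there, and
  convexity turns these bounds into Lipschitz bounds with constants that depend on \<open>H\<close> and \<open>\<D>\<close> only.
\<close>

section \<open>Smooth functions and the symmetry of second derivatives\<close>

lemma smooth_on_partial:
  assumes "smooth_on U f" "b \<in> Basis"
  shows "smooth_on U (\<lambda>x. frechet_derivative f (at x) b)"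
  unfolding smooth_on_def
proof
  fix k
  have "Ck_on (Suc k) U f"
    using assms(1) unfolding smooth_on_def by blast
  then show "Ck_on k U (\<lambda>x. frechet_derivative f (at x) b)"
    using assms(2) by simp
qed

lemma smooth_on_differentiable:
  assumes "smooth_on U f" "x \<in> U"
  shows "f differentiable (at x)"
proof -
  have "Ck_on (Suc 0) U f"
    using assms(1) unfolding smooth_on_def by blast
  then show ?thesis
    using assms(2) by simp
qed

lemma smooth_on_continuous:
  assumes "smooth_on U f"
  shows "continuous_on U f"
proof -
  have "Ck_on 0 U f"
    using assms unfolding smooth_on_def by blast
  then show ?thesis by simp
qed

lemma frechet_derivative_eq_sum_Basis:
  fixes f :: "'a::euclidean_space \<Rightarrow> real"
  assumes "f differentiable (at x)"
  shows "frechet_derivative f (at x) w = (\<Sum>b\<in>Basis. frechet_derivative f (at x) b * (w \<bullet> b))"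
proof -
  have lin: "linear (frechet_derivative f (at x))"
    using assms by (rule linear_frechet_derivative)
  have "frechet_derivative f (at x) w
      = frechet_derivative f (at x) (\<Sum>b\<in>Basis. (w \<bullet> b) *\<^sub>R b)"
    by (simp add: euclidean_representation)
  also have "\<dots> = (\<Sum>b\<in>Basis. frechet_derivative f (at x) b * (w \<bullet> b))"
    by (simp add: linear_sum[OF lin] linear_cmul[OF lin] mult.commute)
  finally show ?thesis .
qed

text \<open>
  The left-hand side is symmetric in \<open>u\<close> and \<open>v\<close>, whereas the right-hand side differentiates first along
  \<open>u\<close> and then along \<open>v\<close>. It comes from the mean value theorem, applied first to the increment
  \<open>a \<mapsto> f (x + a u + s v) - f (x + a u)\<close> and then to the resulting derivative as a function of \<open>b\<close>.
\<close>

lemma mixed_difference_mean_value: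
  fixes f :: "'a::real_normed_vector \<Rightarrow> real"
  assumes s: "s > 0"
    and D: "\<And>a b. a \<in> {0..s} \<Longrightarrow> b \<in> {0..s} \<Longrightarrow> x + a *\<^sub>R u + b *\<^sub>R v \<in> U"
    and f: "\<And>y. y \<in> U \<Longrightarrow> f differentiable (at y)"
    and fu: "\<And>y. y \<in> U \<Longrightarrow> (\<lambda>y. frechet_derivative f (at y) u) differentiable (at y)"
  shows "\<exists>a\<in>{0..s}. \<exists>b\<in>{0..s}.
    f (x + s *\<^sub>R u + s *\<^sub>R v) - f (x + s *\<^sub>R u) - f (x + s *\<^sub>R v) + f x
      = s\<^sup>2 * frechet_derivative (\<lambda>y. frechet_derivative f (at y) u) (at (x + a *\<^sub>R u + b *\<^sub>R v)) v"
proof -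
  define f' where "f' y = frechet_derivative f (at y)" for y
  define g' where "g' y = frechet_derivative (\<lambda>y. f' y u) (at y)" for y
  have f': "(f has_derivative f' y) (at y)" if "y \<in> U" for y
    using f[OF that] unfolding f'_def by (simp add: frechet_derivative_works)
  have g': "((\<lambda>y. f' y u) has_derivative g' y) (at y)" if "y \<in> U" for y
    using fu[OF that] unfolding f'_def g'_def by (simp add: frechet_derivative_works)
  have along_line: "((\<lambda>t. g (c + t *\<^sub>R w + k)) has_derivative (\<lambda>t. G (t *\<^sub>R w))) (at t within T)"
    if "(g has_derivative G) (at (c + t *\<^sub>R w + k))" for g :: "'a \<Rightarrow> real" and G c w k t T
  proof -
    have "((\<lambda>t. c + t *\<^sub>R w + k) has_derivative (\<lambda>t. t *\<^sub>R w)) (at t within T)"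
      by (auto intro!: derivative_eq_intros)
    from has_derivative_compose[OF this that] show ?thesis .
  qed
  have d1: "((\<lambda>a. f (x + a *\<^sub>R u + s *\<^sub>R v) - f (x + a *\<^sub>R u + 0 *\<^sub>R v)) has_derivative
      (\<lambda>t. f' (x + a *\<^sub>R u + s *\<^sub>R v) (t *\<^sub>R u) - f' (x + a *\<^sub>R u + 0 *\<^sub>R v) (t *\<^sub>R u)))
      (at a within {0..s})" if "0 \<le> a" "a \<le> s" for a
    using that s
    by (intro has_derivative_diff along_line[of f _ x a u] f' D) auto
  obtain a where a: "a \<in> {0<..<s}" and mv:
    "f (x + s *\<^sub>R u + s *\<^sub>R v) - f (x + s *\<^sub>R u + 0 *\<^sub>R v)
        - (f (x + 0 *\<^sub>R u + s *\<^sub>R v) - f (x + 0 *\<^sub>R u + 0 *\<^sub>R v))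
      = f' (x + a *\<^sub>R u + s *\<^sub>R v) ((s - 0) *\<^sub>R u) - f' (x + a *\<^sub>R u + 0 *\<^sub>R v) ((s - 0) *\<^sub>R u)"
    using mvt_simple[OF s d1] by blast
  have scale: "f' (x + a *\<^sub>R u + b *\<^sub>R v) (s *\<^sub>R u) = s * f' (x + a *\<^sub>R u + b *\<^sub>R v) u"
    if "b \<in> {0..s}" for b
    using linear_cmul[OF has_derivative_linear[OF f'[OF D]], of a b s u] a that by auto
  have 1: "f (x + s *\<^sub>R u + s *\<^sub>R v) - f (x + s *\<^sub>R u) - f (x + s *\<^sub>R v) + f x
      = s * (f' (x + a *\<^sub>R u + s *\<^sub>R v) u - f' (x + a *\<^sub>R u + 0 *\<^sub>R v) u)"
    using mv scale[of s] scale[of 0] s by (simp add: right_diff_distrib)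
  have d2: "((\<lambda>b. f' (x + a *\<^sub>R u + b *\<^sub>R v) u) has_derivative
      (\<lambda>t. g' (x + a *\<^sub>R u + b *\<^sub>R v) (t *\<^sub>R v))) (at b within {0..s})" if "0 \<le> b" "b \<le> s" for b
    using along_line[of "\<lambda>y. f' y u" "g' (x + a *\<^sub>R u + b *\<^sub>R v)" "x + a *\<^sub>R u" b v 0] g'[OF D] that a
    by auto
  obtain b where b: "b \<in> {0<..<s}" and
    "f' (x + a *\<^sub>R u + s *\<^sub>R v) u - f' (x + a *\<^sub>R u + 0 *\<^sub>R v) u
      = g' (x + a *\<^sub>R u + b *\<^sub>R v) ((s - 0) *\<^sub>R v)"
    using mvt_simple[OF s d2] by blast
  moreover have "g' (x + a *\<^sub>R u + b *\<^sub>R v) (s *\<^sub>R v) = s * g' (x + a *\<^sub>R u + b *\<^sub>R v) v"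
    using linear_cmul[OF has_derivative_linear[OF g'[OF D]], of a b s v] a b by auto
  ultimately have "f' (x + a *\<^sub>R u + s *\<^sub>R v) u - f' (x + a *\<^sub>R u + 0 *\<^sub>R v) u
      = s * g' (x + a *\<^sub>R u + b *\<^sub>R v) v"
    by simp
  with 1 have "f (x + s *\<^sub>R u + s *\<^sub>R v) - f (x + s *\<^sub>R u) - f (x + s *\<^sub>R v) + f x
      = s\<^sup>2 * g' (x + a *\<^sub>R u + b *\<^sub>R v) v"
    by (simp add: power2_eq_square)
  moreover have "a \<in> {0..s}" "b \<in> {0..s}"
    using a b by auto
  ultimately show ?thesis
    unfolding g'_def f'_def by blast
qed

text \<open>
  Clairaut's theorem: by the preceding lemma, both mixed derivatives take a common value, the
  mixed difference quotient, at points arbitrarily close to \<open>x\<close>; continuity identifies them at \<open>x\<close>.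
\<close>

lemma second_partials_commute:
  fixes f :: "'a::real_normed_vector \<Rightarrow> real"
  assumes U: "open U" "x \<in> U"
    and f: "\<And>y. y \<in> U \<Longrightarrow> f differentiable (at y)"
    and fu: "\<And>y. y \<in> U \<Longrightarrow> (\<lambda>y. frechet_derivative f (at y) u) differentiable (at y)"
    and fv: "\<And>y. y \<in> U \<Longrightarrow> (\<lambda>y. frechet_derivative f (at y) v) differentiable (at y)"
    and cuv: "continuous_on U (\<lambda>y. frechet_derivative (\<lambda>y. frechet_derivative f (at y) u) (at y) v)"
    and cvu: "continuous_on U (\<lambda>y. frechet_derivative (\<lambda>y. frechet_derivative f (at y) v) (at y) u)"
  shows "frechet_derivative (\<lambda>y. frechet_derivative f (at y) u) (at x) v
       = frechet_derivative (\<lambda>y. frechet_derivative f (at y) v) (at x) u"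
proof -
  define fuv where "fuv y = frechet_derivative (\<lambda>y. frechet_derivative f (at y) u) (at y) v" for y
  define fvu where "fvu y = frechet_derivative (\<lambda>y. frechet_derivative f (at y) v) (at y) u" for y
  have tuv: "(fuv \<longlongrightarrow> fuv x) (nhds x)" and tvu: "(fvu \<longlongrightarrow> fvu x) (nhds x)"
    using cuv[folded fuv_def] cvu[folded fvu_def] U
    by (simp_all add: continuous_on_eq_continuous_at isCont_def flip: tendsto_at_iff_tendsto_nhds)
  have "dist (fuv x) (fvu x) < 2 * e" if "e > 0" for e
  proof -
    have "\<forall>\<^sub>F y in nhds x. dist (fuv y) (fuv x) < e \<and> dist (fvu y) (fvu x) < e \<and> y \<in> U"
      using tendstoD[OF tuv that] tendstoD[OF tvu that] eventually_nhds_in_open[OF U]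
      by eventually_elim auto
    then obtain d where d: "d > 0" and
      near: "\<And>y. dist y x < d \<Longrightarrow> dist (fuv y) (fuv x) < e \<and> dist (fvu y) (fvu x) < e \<and> y \<in> U"
      unfolding eventually_nhds_metric by blast
    \<comment> \<open>The scale at which the parallelogram spanned by \<open>s u\<close> and \<open>s v\<close> stays in the ball of radius \<open>d\<close>;
        the summand 1 keeps the quotient meaningful when both directions vanish.\<close>
    define s where "s = d / (norm u + norm v + 1)"
    have pos: "norm u + norm v + 1 > 0"
      by (simp add: add_nonneg_pos)
    have s: "s > 0"
      using d pos unfolding s_def by simp
    have in_ball: "dist (x + a *\<^sub>R u + b *\<^sub>R v) x < d" if "a \<in> {0..s}" "b \<in> {0..s}" for a b
    proof -
      have "dist (x + a *\<^sub>R u + b *\<^sub>R v) x \<le> a * norm u + b * norm v"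
        using that norm_triangle_ineq[of "a *\<^sub>R u" "b *\<^sub>R v"] by (simp add: dist_norm add.assoc)
      also have "\<dots> \<le> s * norm u + s * norm v"
        using that by (intro add_mono mult_right_mono) auto
      also have "\<dots> < s * (norm u + norm v + 1)"
        using s by (simp add: algebra_simps)
      also have "\<dots> = d"
        using pos unfolding s_def by simp
      finally show ?thesis .
    qed
    obtain a b where ab: "a \<in> {0..s}" "b \<in> {0..s}"
      and 1: "f (x + s *\<^sub>R u + s *\<^sub>R v) - f (x + s *\<^sub>R u) - f (x + s *\<^sub>R v) + f x
        = s\<^sup>2 * fuv (x + a *\<^sub>R u + b *\<^sub>R v)"
      using mixed_difference_mean_value[OF s near[OF in_ball, THEN conjunct2, THEN conjunct2] f fu]
      unfolding fuv_def by blast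
    have in_ball': "dist (x + a *\<^sub>R v + b *\<^sub>R u) x < d" if "a \<in> {0..s}" "b \<in> {0..s}" for a b
      using in_ball[OF that(2,1)] by (simp add: add_ac)
    obtain a' b' where ab': "a' \<in> {0..s}" "b' \<in> {0..s}"
      and 2: "f (x + s *\<^sub>R v + s *\<^sub>R u) - f (x + s *\<^sub>R v) - f (x + s *\<^sub>R u) + f x
        = s\<^sup>2 * fvu (x + a' *\<^sub>R v + b' *\<^sub>R u)"
      using mixed_difference_mean_value[OF s near[OF in_ball', THEN conjunct2, THEN conjunct2] f fv]
      unfolding fvu_def by blast
    have swap: "x + s *\<^sub>R v + s *\<^sub>R u = x + s *\<^sub>R u + s *\<^sub>R v"
      by (simp add: add_ac)
    have "s\<^sup>2 * fuv (x + a *\<^sub>R u + b *\<^sub>R v) = s\<^sup>2 * fvu (x + a' *\<^sub>R v + b' *\<^sub>R u)"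
      using 1 2[unfolded swap] by linarith
    then have "fuv (x + a *\<^sub>R u + b *\<^sub>R v) = fvu (x + a' *\<^sub>R v + b' *\<^sub>R u)"
      using s by simp
    then show ?thesis
      using near[OF in_ball[OF ab]] near[OF in_ball'[OF ab']]
      unfolding dist_real_def by linarith
  qed
  from this[of "dist (fuv x) (fvu x) / 2"] have "fuv x = fvu x"
    by (cases "fuv x = fvu x") simp_all
  then show ?thesis
    unfolding fuv_def fvu_def .
qed

text \<open>
  On a compact set the function and its partial derivatives are bounded; on a convex set the bound
  on the derivative is a Lipschitz constant.
\<close>

lemma smooth_on_bounded_Lipschitz:
  fixes f :: "'a::euclidean_space \<Rightarrow> real"
  assumes f: "smooth_on U f" and D: "compact D" "convex D" "D \<subseteq> U"
  shows "\<exists>L\<ge>0. (\<forall>x\<in>D. \<bar>f x\<bar> \<le> L) \<and> (\<forall>x\<in>D. \<forall>y\<in>D. \<bar>f x - f y\<bar> \<le> L * norm (x - y))"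
proof -
  have bdd: "\<exists>B\<ge>0. \<forall>x\<in>D. \<bar>g x\<bar> \<le> B" if "smooth_on U g" for g
  proof -
    have "bounded (g ` D)"
      using that D by (meson compact_continuous_image compact_imp_bounded continuous_on_subset
          smooth_on_continuous)
    then show ?thesis
      unfolding bounded_pos by (auto intro: less_imp_le)
  qed
  have "\<forall>b\<in>Basis. \<exists>B\<ge>0. \<forall>x\<in>D. \<bar>frechet_derivative f (at x) b\<bar> \<le> B"
    using bdd smooth_on_partial[OF f] by blast
  then obtain B where B: "\<And>b. b \<in> Basis \<Longrightarrow> B b \<ge> 0"
    "\<And>b x. b \<in> Basis \<Longrightarrow> x \<in> D \<Longrightarrow> \<bar>frechet_derivative f (at x) b\<bar> \<le> B b"
    by metis
  obtain B0 where B0: "B0 \<ge> 0" "\<And>x. x \<in> D \<Longrightarrow> \<bar>f x\<bar> \<le> B0"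
    using bdd[OF f] by blast
  define L where "L = (\<Sum>b\<in>Basis. B b)"
  have L: "L \<ge> 0"
    unfolding L_def using B(1) by (rule sum_nonneg)
  have "\<bar>frechet_derivative f (at x) w\<bar> \<le> L * norm w" if "x \<in> D" for x w
  proof -
    have "\<bar>frechet_derivative f (at x) w\<bar>
        = \<bar>\<Sum>b\<in>Basis. frechet_derivative f (at x) b * (w \<bullet> b)\<bar>"
      using frechet_derivative_eq_sum_Basis smooth_on_differentiable f D that by (metis subsetD)
    also have "\<dots> \<le> (\<Sum>b\<in>Basis. \<bar>frechet_derivative f (at x) b * (w \<bullet> b)\<bar>)"
      by (rule sum_abs)
    also have "\<dots> \<le> (\<Sum>b\<in>Basis. B b * norm w)"
      using B that by (intro sum_mono) (auto simp: abs_mult Basis_le_norm intro!: mult_mono)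
    finally show ?thesis
      by (simp add: L_def sum_distrib_right)
  qed
  then have onorm_le: "onorm (frechet_derivative f (at x)) \<le> L" if "x \<in> D" for x
    using that L by (intro onorm_bound) auto
  have "\<bar>f x - f y\<bar> \<le> L * norm (x - y)" if "x \<in> D" "y \<in> D" for x y
  proof -
    have "(f has_derivative frechet_derivative f (at z)) (at z within D)" if "z \<in> D" for z
      using smooth_on_differentiable[OF f] D that
      by (meson frechet_derivative_works has_derivative_at_withinI subsetD)
    from differentiable_bound[OF D(2) this onorm_le that] show ?thesis
      by simp
  qed
  moreover have "L * norm (x - y) \<le> (B0 + L) * norm (x - y)" for x y :: 'a
    using B0 by (intro mult_right_mono) auto
  ultimately have "\<bar>f x - f y\<bar> \<le> (B0 + L) * norm (x - y)" if "x \<in> D" "y \<in> D" for x y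
    using that by (meson order_trans)
  moreover have "\<bar>f x\<bar> \<le> B0 + L" if "x \<in> D" for x
    using B0(2)[OF that] L by simp
  ultimately show ?thesis
    using B0(1) L by (intro exI[of _ "B0 + L"]) simp
qed

lemma sum_bounded_Lipschitz:
  fixes f :: "'i \<Rightarrow> 'b::real_normed_vector \<Rightarrow> real"
  assumes "\<And>i. i \<in> I \<Longrightarrow> \<exists>L\<ge>0. (\<forall>x\<in>D. \<bar>f i x\<bar> \<le> L) \<and>
      (\<forall>x\<in>D. \<forall>y\<in>D. \<bar>f i x - f i y\<bar> \<le> L * norm (x - y))"
  shows "\<exists>L\<ge>0. (\<forall>x\<in>D. (\<Sum>i\<in>I. \<bar>f i x\<bar>) \<le> L) \<and>
      (\<forall>x\<in>D. \<forall>y\<in>D. (\<Sum>i\<in>I. \<bar>f i x - f i y\<bar>) \<le> L * norm (x - y))"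
proof -
  obtain L where L: "\<And>i. i \<in> I \<Longrightarrow> L i \<ge> 0"
    "\<And>i x. i \<in> I \<Longrightarrow> x \<in> D \<Longrightarrow> \<bar>f i x\<bar> \<le> L i"
    "\<And>i x y. i \<in> I \<Longrightarrow> x \<in> D \<Longrightarrow> y \<in> D \<Longrightarrow> \<bar>f i x - f i y\<bar> \<le> L i * norm (x - y)"
    using assms by metis
  show ?thesis
    using L by (intro exI[of _ "\<Sum>i\<in>I. L i"])
      (auto simp: sum_distrib_right intro!: sum_nonneg sum_mono)
qed

lemma norm_sum_scaleR_Basis_le:
  "norm (\<Sum>b\<in>Basis. t b *\<^sub>R b :: 'a::euclidean_space) \<le> (\<Sum>b\<in>Basis. \<bar>t b\<bar>)"
  using norm_sum[of "\<lambda>b. t b *\<^sub>R b" "Basis :: 'a set"] by simp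

text \<open>
  For the linear map with matrix entries \<open>t (b, c)\<close>, the operator norm is at most the sum of the absolute
  values of the entries. Being stated for arbitrary entries, it serves for a Hessian and for a
  difference of two Hessians alike.
\<close>

lemma norm_matrix_sum_Basis_le:
  fixes w :: "'a::euclidean_space"
  shows "norm (\<Sum>b\<in>Basis. (\<Sum>c\<in>Basis. t (b, c) * (w \<bullet> c)) *\<^sub>R b :: 'a)
    \<le> (\<Sum>i\<in>Basis \<times> Basis. \<bar>t i\<bar>) * norm w"
proof -
  have "norm (\<Sum>b\<in>Basis. (\<Sum>c\<in>Basis. t (b, c) * (w \<bullet> c)) *\<^sub>R b :: 'a)
      \<le> (\<Sum>b\<in>Basis. \<bar>\<Sum>c\<in>Basis. t (b, c) * (w \<bullet> c)\<bar>)"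
    by (rule norm_sum_scaleR_Basis_le)
  also have "\<dots> \<le> (\<Sum>b\<in>(Basis :: 'a set). \<Sum>c\<in>Basis. \<bar>t (b, c)\<bar> * norm w)"
    by (intro sum_mono order_trans[OF sum_abs])
      (auto simp: abs_mult Basis_le_norm intro!: mult_left_mono)
  finally show ?thesis
    by (simp add: sum.cartesian_product sum_distrib_right case_prod_unfold)
qed

text \<open>
  All analytic information on the Hamiltonian that the numerical scheme needs. Both bounds for the
  Hessian are inherited entry by entry from second partial derivatives, which are smooth again.
\<close>

lemma smooth_on_gradient_Hessian:
  fixes H :: "'a::euclidean_space \<Rightarrow> real"
  assumes H: "smooth_on U H" and U: "open U" and D: "compact D" "convex D" "D \<subseteq> U"
  obtains G A K where
    "\<forall>z\<in>U. GDERIV H z :> G z"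
    "\<forall>z\<in>U. (G has_derivative A z) (at z)"
    "\<forall>z\<in>U. \<forall>v w. A z v \<bullet> w = A z w \<bullet> v"
    "K \<ge> 0"
    "\<forall>z\<in>D. norm (G z) \<le> K"
    "\<forall>y\<in>D. \<forall>z\<in>D. norm (G y - G z) \<le> K * norm (y - z)"
    "\<forall>z\<in>D. \<forall>w. norm (A z w) \<le> K * norm w"
    "\<forall>y\<in>D. \<forall>z\<in>D. \<forall>w. norm (A y w - A z w) \<le> K * norm (y - z) * norm w"
proof -
  define p where "p b z = frechet_derivative H (at z) b" for b z
  define pp where "pp i z = frechet_derivative (p (fst i)) (at z) (snd i)" for i z
  define G :: "'a \<Rightarrow> 'a" where "G z = (\<Sum>b\<in>Basis. p b z *\<^sub>R b)" for z
  define A :: "'a \<Rightarrow> 'a \<Rightarrow> 'a"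
    where "A z w = (\<Sum>b\<in>Basis. (\<Sum>c\<in>Basis. pp (b, c) z * (w \<bullet> c)) *\<^sub>R b)" for z w
  have p: "smooth_on U (p b)" if "b \<in> Basis" for b
    unfolding p_def[abs_def] using H that by (rule smooth_on_partial)
  have pp: "smooth_on U (pp i)" if "i \<in> Basis \<times> Basis" for i
    unfolding pp_def[abs_def] using that by (intro smooth_on_partial p) auto
  have pp_commute: "pp (b, c) z = pp (c, b) z" if "b \<in> Basis" "c \<in> Basis" "z \<in> U" for b c z
    using second_partials_commute[OF U \<open>z \<in> U\<close> smooth_on_differentiable[OF H], of b c]
      smooth_on_differentiable[OF p[OF that(1)]] smooth_on_differentiable[OF p[OF that(2)]]
      smooth_on_continuous[OF pp, of "(b, c)"] smooth_on_continuous[OF pp, of "(c, b)"] that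
    unfolding pp_def p_def by simp
  have "\<exists>L\<ge>0. (\<forall>x\<in>D. (\<Sum>b\<in>Basis. \<bar>p b x\<bar>) \<le> L) \<and>
      (\<forall>x\<in>D. \<forall>y\<in>D. (\<Sum>b\<in>Basis. \<bar>p b x - p b y\<bar>) \<le> L * norm (x - y))"
    by (intro sum_bounded_Lipschitz smooth_on_bounded_Lipschitz[OF p D])
  then obtain L where L: "L \<ge> 0" "\<forall>x\<in>D. (\<Sum>b\<in>Basis. \<bar>p b x\<bar>) \<le> L"
    "\<forall>x\<in>D. \<forall>y\<in>D. (\<Sum>b\<in>Basis. \<bar>p b x - p b y\<bar>) \<le> L * norm (x - y)"
    by (elim exE conjE) (rule that)
  have "\<exists>L\<ge>0. (\<forall>x\<in>D. (\<Sum>i\<in>Basis \<times> Basis. \<bar>pp i x\<bar>) \<le> L) \<and>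
      (\<forall>x\<in>D. \<forall>y\<in>D. (\<Sum>i\<in>Basis \<times> Basis. \<bar>pp i x - pp i y\<bar>) \<le> L * norm (x - y))"
    by (intro sum_bounded_Lipschitz smooth_on_bounded_Lipschitz[OF pp D])
  then obtain L' where L': "L' \<ge> 0" "\<forall>x\<in>D. (\<Sum>i\<in>Basis \<times> Basis. \<bar>pp i x\<bar>) \<le> L'"
    "\<forall>x\<in>D. \<forall>y\<in>D. (\<Sum>i\<in>Basis \<times> Basis. \<bar>pp i x - pp i y\<bar>) \<le> L' * norm (x - y)"
    by (elim exE conjE) (rule that)
  show thesis
  proof (rule that[of G A "L + L'"]; (intro ballI allI)?)
    fix z assume z: "z \<in> U"
    have "frechet_derivative H (at z) = (\<lambda>w. w \<bullet> G z)"
    proof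
      show "frechet_derivative H (at z) w = w \<bullet> G z" for w
        unfolding frechet_derivative_eq_sum_Basis[OF smooth_on_differentiable[OF H z], of w]
        by (simp add: G_def p_def inner_sum_right)
    qed
    then show "GDERIV H z :> G z"
      unfolding gderiv_def
      using smooth_on_differentiable[OF H z] by (simp add: frechet_derivative_works)
    have "(p b has_derivative (\<lambda>w. \<Sum>c\<in>Basis. pp (b, c) z * (w \<bullet> c))) (at z)" if "b \<in> Basis" for b
    proof -
      have "frechet_derivative (p b) (at z) = (\<lambda>w. \<Sum>c\<in>Basis. pp (b, c) z * (w \<bullet> c))"
      proof
        show "frechet_derivative (p b) (at z) w = (\<Sum>c\<in>Basis. pp (b, c) z * (w \<bullet> c))" for w
          unfolding frechet_derivative_eq_sum_Basis[OF smooth_on_differentiable[OF p[OF that] z], of w]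
          by (simp add: pp_def)
      qed
      then show ?thesis
        using smooth_on_differentiable[OF p[OF that] z] by (simp add: frechet_derivative_works)
    qed
    then show "(G has_derivative A z) (at z)"
      unfolding G_def[abs_def] A_def[abs_def] by (intro has_derivative_sum has_derivative_scaleR_left)
    have expand: "A z v \<bullet> w = (\<Sum>b\<in>Basis. \<Sum>c\<in>Basis. pp (b, c) z * (v \<bullet> c) * (w \<bullet> b))" for v w
      unfolding A_def by (simp add: inner_sum_left sum_distrib_right inner_commute[of w])
    show "A z v \<bullet> w = A z w \<bullet> v" for v w
    proof -
      have "A z v \<bullet> w = (\<Sum>c\<in>Basis. \<Sum>b\<in>Basis. pp (b, c) z * (v \<bullet> c) * (w \<bullet> b))"
        unfolding expand by (rule sum.swap)
      also have "\<dots> = (\<Sum>c\<in>Basis. \<Sum>b\<in>Basis. pp (c, b) z * (w \<bullet> b) * (v \<bullet> c))"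
        using pp_commute z by (intro sum.cong refl) (simp add: mult.commute mult.left_commute)
      also have "\<dots> = A z w \<bullet> v"
        unfolding expand ..
      finally show ?thesis .
    qed
  next
    show "L + L' \<ge> 0"
      using L(1) L'(1) by simp
  next
    fix z assume z: "z \<in> D"
    show "norm (G z) \<le> L + L'"
      using norm_sum_scaleR_Basis_le[of "\<lambda>b. p b z"] L(2)[rule_format, OF z] L'(1) unfolding G_def by linarith
    have "norm (A z w) \<le> (\<Sum>i\<in>Basis \<times> Basis. \<bar>pp i z\<bar>) * norm w" for w
      unfolding A_def by (rule norm_matrix_sum_Basis_le[of "\<lambda>i. pp i z"])
    moreover have "(\<Sum>i\<in>Basis \<times> Basis. \<bar>pp i z\<bar>) * norm w \<le> (L + L') * norm w" for w :: 'a
      using L'(2)[rule_format, OF z] L(1) by (intro mult_right_mono) auto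
    ultimately show "norm (A z w) \<le> (L + L') * norm w" for w
      by (meson order_trans)
  next
    fix y z assume yz: "y \<in> D" "z \<in> D"
    have mono: "L * norm (y - z) \<le> (L + L') * norm (y - z)" "L' * norm (y - z) \<le> (L + L') * norm (y - z)"
      using L(1) L'(1) by (auto intro: mult_right_mono)
    have "G y - G z = (\<Sum>b\<in>Basis. (p b y - p b z) *\<^sub>R b)"
      unfolding G_def by (simp add: sum_subtractf scaleR_left_diff_distrib)
    then show "norm (G y - G z) \<le> (L + L') * norm (y - z)"
      using norm_sum_scaleR_Basis_le[of "\<lambda>b. p b y - p b z"] L(3)[rule_format, OF yz] mono(1) by simp
    have diff: "A y w - A z w
        = (\<Sum>b\<in>Basis. (\<Sum>c\<in>Basis. (pp (b, c) y - pp (b, c) z) * (w \<bullet> c)) *\<^sub>R b)" for w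
      unfolding A_def by (simp add: sum_subtractf scaleR_left_diff_distrib left_diff_distrib)
    have "norm (A y w - A z w) \<le> (\<Sum>i\<in>Basis \<times> Basis. \<bar>pp i y - pp i z\<bar>) * norm w" for w
      unfolding diff by (rule norm_matrix_sum_Basis_le[of "\<lambda>i. pp i y - pp i z"])
    moreover have "(\<Sum>i\<in>Basis \<times> Basis. \<bar>pp i y - pp i z\<bar>) * norm w
        \<le> (L + L') * norm (y - z) * norm w" for w :: 'a
      using L'(3)[rule_format, OF yz] mono(2) by (intro mult_right_mono) auto
    ultimately show "norm (A y w - A z w) \<le> (L + L') * norm (y - z) * norm w" for w
      by (meson order_trans)
  qed
qed

section \<open>Derivative of the numerical flow\<close>

lemma partial_gradients:
  fixes H :: "(real^'n) \<times> (real^'n) \<Rightarrow> real"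
  assumes "GDERIV H z :> g"
  shows "grad_q H z = fst g" "grad_p H z = snd g"
proof -
  have d: "(H has_derivative (\<lambda>w. w \<bullet> g)) (at (fst z, snd z))"
    using assms unfolding gderiv_def by simp
  have "((\<lambda>q. (q, snd z)) has_derivative (\<lambda>v. (v, 0))) (at (fst z))"
    by (auto intro!: derivative_eq_intros)
  from has_derivative_compose[OF this d]
  have "GDERIV (\<lambda>q. H (q, snd z)) (fst z) :> fst g"
    unfolding gderiv_def by (simp add: inner_prod_def)
  then show "grad_q H z = fst g"
    unfolding grad_q_def by (rule grad_eqI)
  have "((\<lambda>p. (fst z, p)) has_derivative (\<lambda>v. (0, v))) (at (snd z))"
    by (auto intro!: derivative_eq_intros)
  from has_derivative_compose[OF this d]
  have "GDERIV (\<lambda>p. H (fst z, p)) (snd z) :> snd g"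
    unfolding gderiv_def by (simp add: inner_prod_def)
  then show "grad_p H z = snd g"
    unfolding grad_p_def by (rule grad_eqI)
qed

lemma norm_component_le:
  fixes w :: "'a::real_normed_vector \<times> 'b::real_normed_vector"
  shows "norm (fst w) \<le> norm w" "norm (snd w) \<le> norm w"
  by (cases w; simp add: norm_fst_le norm_snd_le)+

text \<open>
  The linearised fixed point iteration, with \<open>A z\<close> in the role of the Hessian of \<open>H\<close> at \<open>z\<close>: the derivative
  of the \<open>n\<close>-th iterate in direction \<open>w\<close>. Defining it by its own recursion, rather than as a Frechet
  derivative, makes it possible to compare consecutive iterates algebraically.
\<close>

primrec tangent_iter ::
  "((real^'n) \<times> (real^'n) \<Rightarrow> (real^'n) \<times> (real^'n) \<Rightarrow> (real^'n) \<times> (real^'n)) \<Rightarrow>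
   ((real^'n) \<times> (real^'n) \<Rightarrow> real) \<Rightarrow> real \<Rightarrow> (real^'n) \<times> (real^'n) \<Rightarrow> nat \<Rightarrow>
   (real^'n) \<times> (real^'n) \<Rightarrow> real^'n" where
  "tangent_iter A H h z 0 w = fst w"
| "tangent_iter A H h z (Suc n) w = fst w +
     h *\<^sub>R snd (A (fp_iter H h (fst z) (snd z) n, snd z) (tangent_iter A H h z n w, snd w))"

lemma fp_iter_has_derivative:
  fixes H :: "(real^'n) \<times> (real^'n) \<Rightarrow> real"
  assumes "\<And>n. n < m \<Longrightarrow>
    (grad_p H has_derivative (\<lambda>w. snd (A (fp_iter H h (fst z) (snd z) n, snd z) w)))
      (at (fp_iter H h (fst z) (snd z) n, snd z))"
  shows "((\<lambda>z. fp_iter H h (fst z) (snd z) m) has_derivative tangent_iter A H h z m) (at z)"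
  using assms
proof (induction m)
  case 0
  show ?case
    by (auto intro!: derivative_eq_intros simp: fun_eq_iff)
next
  case (Suc m)
  have "((\<lambda>z. (fp_iter H h (fst z) (snd z) m, snd z)) has_derivative
      (\<lambda>w. (tangent_iter A H h z m w, snd w))) (at z)"
    using Suc by (intro has_derivative_Pair has_derivative_snd has_derivative_ident) auto
  from has_derivative_compose[OF this Suc.prems[OF lessI]]
  show ?case
    by (auto intro!: derivative_eq_intros simp: fun_eq_iff)
qed

lemma num_flow_has_derivative:
  fixes H :: "(real^'n) \<times> (real^'n) \<Rightarrow> real"
  assumes U: "open U" and G: "\<And>z. z \<in> U \<Longrightarrow> GDERIV H z :> G z"
    and A: "\<And>z. z \<in> U \<Longrightarrow> (G has_derivative A z) (at z)"
    and in_U: "\<And>n. n \<le> M \<Longrightarrow> (fp_iter H h (fst z) (snd z) n, snd z) \<in> U"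
  shows "(num_flow H M h has_derivative
    (\<lambda>w. (tangent_iter A H h z M w, snd w -
      h *\<^sub>R fst (A (fp_iter H h (fst z) (snd z) M, snd z) (tangent_iter A H h z M w, snd w))))) (at z)"
proof -
  \<comment> \<open>The partial gradients agree with the components of \<open>G\<close> on the open set \<open>U\<close> only, hence the passage to
      a neighbourhood.\<close>
  have grad: "(grad_q H has_derivative (\<lambda>w. fst (A y w))) (at y)"
    "(grad_p H has_derivative (\<lambda>w. snd (A y w))) (at y)" if "y \<in> U" for y
    using has_derivative_transform_within_open[OF has_derivative_fst[OF A[OF that]] U that]
      has_derivative_transform_within_open[OF has_derivative_snd[OF A[OF that]] U that]
      partial_gradients[OF G] by (metis (no_types, lifting))+
  have q: "((\<lambda>z. fp_iter H h (fst z) (snd z) M) has_derivative tangent_iter A H h z M) (at z)"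
    using grad(2) in_U by (intro fp_iter_has_derivative) auto
  then have "((\<lambda>z. (fp_iter H h (fst z) (snd z) M, snd z)) has_derivative
      (\<lambda>w. (tangent_iter A H h z M w, snd w))) (at z)"
    by (intro has_derivative_Pair has_derivative_snd has_derivative_ident)
  from has_derivative_compose[OF this grad(1)[OF in_U[OF order_refl]]]
  show ?thesis
    unfolding num_flow_def[abs_def] Let_def using q
    by (auto intro!: derivative_eq_intros simp: fun_eq_iff)
qed

section \<open>The symplectic defect of one step\<close>

definition symplectic_form :: "'a::real_inner \<times> 'a \<Rightarrow> 'a \<times> 'a \<Rightarrow> real" where
  "symplectic_form v w = fst v \<bullet> snd w - snd v \<bullet> fst w"

text \<open>
  Here \<open>q = T\<^sub>M w\<close> and \<open>q' = T\<^sub>M w'\<close>, and \<open>d\<close>, \<open>d'\<close> measure how far these are from being fixed under one more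
  iteration. The Hessian terms of the \<open>p\<close> update pair with \<open>q\<close> and \<open>q'\<close>; symmetry of \<open>A\<close> trades them for
  terms that pair with \<open>w\<^sub>p\<close> and \<open>w'\<^sub>p\<close>, which are precisely those occurring in \<open>d\<close> and \<open>d'\<close>.
\<close>

lemma symplectic_form_derivative_step:
  fixes a w :: "'a::real_inner \<times> 'a"
  assumes sym: "A (q, snd w) \<bullet> (q', snd w') = A (q', snd w') \<bullet> (q, snd w)"
    and d: "d = q - (fst w + h *\<^sub>R snd (A (q, snd w)))"
    and d': "d' = q' - (fst w' + h *\<^sub>R snd (A (q', snd w')))"
  shows "symplectic_form (q, snd w - h *\<^sub>R fst (A (q, snd w))) (q', snd w' - h *\<^sub>R fst (A (q', snd w')))
    = symplectic_form w w' + d \<bullet> snd w' - snd w \<bullet> d'"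
proof -
  define a a' where "a = A (q, snd w)" and "a' = A (q', snd w')"
  have "fst a \<bullet> q' + snd a \<bullet> snd w' = fst a' \<bullet> q + snd a' \<bullet> snd w"
    using sym unfolding a_def a'_def inner_prod_def by simp
  then have "h * (fst a \<bullet> q' + snd a \<bullet> snd w') = h * (fst a' \<bullet> q + snd a' \<bullet> snd w)"
    by simp
  then show ?thesis
    unfolding d d' symplectic_form_def a_def[symmetric] a'_def[symmetric]
    by (simp add: algebra_simps inner_commute)
qed

section \<open>Contraction of the fixed point iteration and of its linearisation\<close>

lemma fp_iter_difference_bound:
  fixes H :: "(real^'n) \<times> (real^'n) \<Rightarrow> real"
  assumes K: "K \<ge> 0" and h: "h > 0"
    and bound: "\<And>z. z \<in> D \<Longrightarrow> norm (grad_p H z) \<le> K"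
    and Lipschitz: "\<And>y z. y \<in> D \<Longrightarrow> z \<in> D \<Longrightarrow> norm (grad_p H y - grad_p H z) \<le> K * norm (y - z)"
    and in_D: "\<And>n. n \<le> m \<Longrightarrow> (fp_iter H h q p n, p) \<in> D"
  shows "norm (fp_iter H h q p (Suc m) - fp_iter H h q p m) \<le> (K * h) ^ Suc m"
  using in_D
proof (induction m)
  case 0
  then show ?case
    using bound[of "(q, p)"] h by (simp add: mult.commute)
next
  case (Suc m)
  define x where "x n = fp_iter H h q p n" for n
  have "norm (x (Suc (Suc m)) - x (Suc m)) = h * norm (grad_p H (x (Suc m), p) - grad_p H (x m, p))"
    using h unfolding x_def by (simp flip: scaleR_diff_right)
  also have "\<dots> \<le> h * (K * norm ((x (Suc m), p) - (x m, p)))"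
    using Suc.prems[of "Suc m"] Suc.prems[of m] h unfolding x_def
    by (intro mult_left_mono Lipschitz) auto
  also have "\<dots> = (K * h) * norm (x (Suc m) - x m)"
    by (simp add: norm_Pair)
  also have "\<dots> \<le> (K * h) * (K * h) ^ Suc m"
    using K h Suc unfolding x_def by (intro mult_left_mono) auto
  finally show ?case
    unfolding x_def by simp
qed

text \<open>
  One step maps a bound \<open>c \<ge> 1\<close> on the operator norm to \<open>1 + h K (c + 1)\<close>, which is at most \<open>(1 + 2 K) c\<close>
  for \<open>h \<le> 1\<close>.
\<close>

lemma tangent_iter_bound:
  fixes H :: "(real^'n) \<times> (real^'n) \<Rightarrow> real"
  assumes K: "K \<ge> 0" and h: "0 < h" "h \<le> 1"
    and bound: "\<And>z w. z \<in> D \<Longrightarrow> norm (A z w) \<le> K * norm w"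
    and in_D: "\<And>n. n < m \<Longrightarrow> (fp_iter H h (fst z) (snd z) n, snd z) \<in> D"
  shows "norm (tangent_iter A H h z m w) \<le> (1 + 2 * K) ^ m * norm w"
  using in_D
proof (induction m)
  case 0
  then show ?case
    by (simp add: norm_component_le(1))
next
  case (Suc m)
  define c where "c = (1 + 2 * K) ^ m"
  have c: "c \<ge> 1"
    unfolding c_def using K by simp
  define y where "y = (fp_iter H h (fst z) (snd z) m, snd z)"
  define t where "t = tangent_iter A H h z m w"
  have t: "norm t \<le> c * norm w"
    using Suc unfolding t_def c_def by simp
  have "norm (tangent_iter A H h z (Suc m) w) \<le> norm (fst w) + h * norm (snd (A y (t, snd w)))"
    using norm_triangle_ineq[of "fst w" "h *\<^sub>R snd (A y (t, snd w))"] h unfolding y_def t_def by simp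
  also have "\<dots> \<le> norm w + 1 * (K * (c * norm w + norm w))"
  proof (intro add_mono mult_mono)
    have "norm (snd (A y (t, snd w))) \<le> norm (A y (t, snd w))"
      by (rule norm_component_le(2))
    also have "\<dots> \<le> K * norm (t, snd w)"
      using Suc.prems[of m] unfolding y_def by (intro bound) simp
    also have "\<dots> \<le> K * (c * norm w + norm w)"
      using K t norm_component_le(2)[of w] norm_Pair_le[of t "snd w"] by (intro mult_left_mono) auto
    finally show "norm (snd (A y (t, snd w))) \<le> K * (c * norm w + norm w)" .
  qed (use h in \<open>auto simp: norm_component_le(1)\<close>)
  also have "\<dots> = (1 + K * c + K) * norm w"
    by (simp add: algebra_simps)
  also have "\<dots> \<le> ((1 + 2 * K) * c) * norm w"
  proof (rule mult_right_mono)
    have "1 + K \<le> (1 + K) * c"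
      using K c mult_left_mono[of 1 c "1 + K"] by simp
    then show "1 + K * c + K \<le> (1 + 2 * K) * c"
      by (simp add: algebra_simps)
  qed simp
  finally show ?case
    unfolding c_def by (simp add: mult_ac)
qed

text \<open>
  The difference of consecutive steps of the linearised iteration splits into the effect of the
  different tangent vectors, to which the induction hypothesis applies, and that of the different
  base points, whose distance is controlled by the contraction of the iterates themselves. Both
  acquire one factor \<open>h\<close>. The constant does not involve \<open>h\<close>, \<open>z\<close> or \<open>w\<close>.
\<close>

lemma tangent_iter_difference_bound:
  fixes H :: "(real^'n) \<times> (real^'n) \<Rightarrow> real"
  assumes K: "K \<ge> 0"
    and g_bound: "\<And>z. z \<in> D \<Longrightarrow> norm (grad_p H z) \<le> K"
    and g_Lipschitz: "\<And>y z. y \<in> D \<Longrightarrow> z \<in> D \<Longrightarrow> norm (grad_p H y - grad_p H z) \<le> K * norm (y - z)"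
    and A_linear: "\<And>z. z \<in> D \<Longrightarrow> linear (A z)"
    and A_bound: "\<And>z w. z \<in> D \<Longrightarrow> norm (A z w) \<le> K * norm w"
    and A_Lipschitz: "\<And>y z w. y \<in> D \<Longrightarrow> z \<in> D \<Longrightarrow>
      norm (A y w - A z w) \<le> K * norm (y - z) * norm w"
  shows "\<exists>C\<ge>0. \<forall>h z w. 0 < h \<and> h \<le> 1 \<and>
      (\<forall>n\<le>m. (fp_iter H h (fst z) (snd z) n, snd z) \<in> D) \<longrightarrow>
    norm (tangent_iter A H h z (Suc m) w - tangent_iter A H h z m w) \<le> C * h ^ Suc m * norm w"
proof (induction m)
  case 0
  have "norm (h *\<^sub>R snd (A z w)) \<le> K * h * norm w" if "h > 0" "z \<in> D" for h z w
    using order_trans[OF norm_component_le(2) A_bound[OF that(2)], of w] that by (simp add: mult_ac)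
  then show ?case
    using K by (intro exI[of _ K]) auto
next
  case (Suc m)
  then obtain C where C: "C \<ge> 0" and
    IH: "\<And>h z w. 0 < h \<Longrightarrow> h \<le> 1 \<Longrightarrow> (\<forall>n\<le>m. (fp_iter H h (fst z) (snd z) n, snd z) \<in> D) \<Longrightarrow>
      norm (tangent_iter A H h z (Suc m) w - tangent_iter A H h z m w) \<le> C * h ^ Suc m * norm w"
    by blast
  \<comment> \<open>First summand: the induction hypothesis amplified by the Hessian bound. Second: Lipschitz constant of
      the Hessian, times the distance of the base points, times the size of the argument.\<close>
  define C' where "C' = K * C + K * K ^ Suc m * ((1 + 2 * K) ^ m + 1)"
  have "C' \<ge> 0"
    unfolding C'_def using K C by simp
  moreover have "norm (tangent_iter A H h z (Suc (Suc m)) w - tangent_iter A H h z (Suc m) w)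
      \<le> C' * h ^ Suc (Suc m) * norm w"
    if h: "0 < h" "h \<le> 1" and in_D: "\<forall>n\<le>Suc m. (fp_iter H h (fst z) (snd z) n, snd z) \<in> D"
    for h z w
  proof -
    define y where "y n = (fp_iter H h (fst z) (snd z) n, snd z)" for n
    define t where "t n = tangent_iter A H h z n w" for n
    have y: "y n \<in> D" if "n \<le> Suc m" for n
      using in_D that unfolding y_def by blast
    have t_diff: "norm (t (Suc m) - t m) \<le> C * h ^ Suc m * norm w"
      unfolding t_def using in_D by (intro IH h) auto
    have t_bound: "norm (t m) \<le> (1 + 2 * K) ^ m * norm w"
      unfolding t_def using in_D by (intro tangent_iter_bound[OF K h A_bound]) auto
    have y_diff: "norm (y (Suc m) - y m) \<le> (K * h) ^ Suc m"
      using fp_iter_difference_bound[OF K h(1) g_bound g_Lipschitz, of D m "fst z" "snd z"] in_D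
      unfolding y_def by (simp add: norm_Pair)
    have "A (y (Suc m)) (t (Suc m), snd w) - A (y (Suc m)) (t m, snd w) = A (y (Suc m)) (t (Suc m) - t m, 0)"
      using linear_diff[OF A_linear[OF y[OF order_refl]], of "(t (Suc m), snd w)" "(t m, snd w)"] by simp
    then have split: "A (y (Suc m)) (t (Suc m), snd w) - A (y m) (t m, snd w) = A (y (Suc m)) (t (Suc m) - t m, 0)
        + (A (y (Suc m)) (t m, snd w) - A (y m) (t m, snd w))"
      by (simp add: algebra_simps)
    have 1: "norm (A (y (Suc m)) (t (Suc m) - t m, 0)) \<le> K * (C * h ^ Suc m * norm w)"
      using A_bound[OF y[OF order_refl], of "(t (Suc m) - t m, 0)"] mult_left_mono[OF t_diff K]
      by (simp add: norm_Pair)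
    have pair: "norm (t m, snd w) \<le> ((1 + 2 * K) ^ m + 1) * norm w"
      using norm_Pair_le[of "t m" "snd w"] t_bound norm_component_le(2)[of w] by (simp add: distrib_right)
    have "norm (A (y (Suc m)) (t m, snd w) - A (y m) (t m, snd w))
        \<le> K * norm (y (Suc m) - y m) * norm (t m, snd w)"
      by (intro A_Lipschitz y) auto
    also have "\<dots> \<le> K * (K * h) ^ Suc m * (((1 + 2 * K) ^ m + 1) * norm w)"
      using y_diff pair K h by (intro mult_mono) auto
    finally have "norm (A (y (Suc m)) (t (Suc m), snd w) - A (y m) (t m, snd w))
        \<le> K * (C * h ^ Suc m * norm w) + K * (K * h) ^ Suc m * (((1 + 2 * K) ^ m + 1) * norm w)"
      unfolding split by (intro order_trans[OF norm_triangle_ineq] add_mono 1)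
    also have "\<dots> = C' * h ^ Suc m * norm w"
      unfolding C'_def power_mult_distrib by (simp add: algebra_simps)
    finally have A_diff: "norm (A (y (Suc m)) (t (Suc m), snd w) - A (y m) (t m, snd w))
        \<le> C' * h ^ Suc m * norm w" .
    have "t (Suc (Suc m)) - t (Suc m) = h *\<^sub>R snd (A (y (Suc m)) (t (Suc m), snd w) - A (y m) (t m, snd w))"
      unfolding t_def y_def by (simp add: scaleR_diff_right)
    then have "norm (t (Suc (Suc m)) - t (Suc m)) \<le> h * (C' * h ^ Suc m * norm w)"
      using order_trans[OF norm_component_le(2) A_diff] h by simp
    then show ?thesis
      unfolding t_def by (simp add: mult_ac)
  qed
  ultimately show ?case
    by blast
qed

section \<open>Phase space coordinates\<close>

lemma linear_pack: "linear pack"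
  by (rule linearI) (auto simp: pack_def vec_eq_iff split: sum.split)

lemma linear_unpack: "linear unpack"
  by (rule linearI) (auto simp: unpack_def vec_eq_iff)

lemma sum_UNIV_Plus:
  "(\<Sum>i\<in>(UNIV :: ('a::finite + 'b::finite) set). f i) = (\<Sum>a\<in>UNIV. f (Inl a)) + (\<Sum>b\<in>UNIV. f (Inr b))"
  using sum.Plus[of "UNIV :: 'a set" "UNIV :: 'b set" f] by (simp add: o_def)

lemma inner_pack_J_mat_pack: "pack v \<bullet> (J_mat *v pack w) = symplectic_form v w"
proof -
  have "J_mat *v pack w = pack (snd w, - fst w)"
    by (auto simp: J_mat_def block_mat_def pack_def matrix_vector_mult_def vec_eq_iff sum_UNIV_Plus
        mat_def if_distrib[of "\<lambda>x. x * _"] if_distrib[of uminus] cong: if_cong split: sum.split)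
  then show ?thesis
    by (simp add: symplectic_form_def pack_def inner_vec_def sum_UNIV_Plus sum_negf)
qed

lemma unpack_axis:
  "unpack (axis (Inl a) x) = (axis a x, 0)" "unpack (axis (Inr a) x) = (0, axis a x)"
  by (auto simp: unpack_def axis_def vec_eq_iff)

lemma jacobian_at_mult:
  fixes F :: "(real^'n) \<times> (real^'n) \<Rightarrow> (real^'n) \<times> (real^'n)"
  assumes "(F has_derivative F') (at z)"
  shows "jacobian_at F z *v v = pack (F' (unpack v))"
proof -
  have "bounded_linear (unpack :: _ \<Rightarrow> (real^'n) \<times> (real^'n))"
    using linear_unpack by (simp add: linear_linear)
  then have "(unpack has_derivative unpack) (at (pack z))"
    by (rule bounded_linear_imp_has_derivative)
  then have "((\<lambda>v. F (unpack v)) has_derivative (\<lambda>v. F' (unpack v))) (at (pack z))"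
    by (rule has_derivative_compose) (simp add: assms)
  moreover have "bounded_linear (pack :: (real^'n) \<times> (real^'n) \<Rightarrow> _)"
    using linear_pack by (simp add: linear_linear)
  ultimately have d: "((\<lambda>v. pack (F (unpack v))) has_derivative (\<lambda>v. pack (F' (unpack v)))) (at (pack z))"
    using bounded_linear.has_derivative by blast
  show ?thesis
    unfolding jacobian_at_def jacobian_def frechet_derivative_at[OF d, symmetric]
    using has_derivative_linear[OF d] by (simp add: linear_matrix_vector_mul_eq matrix_works)
qed

text \<open>
  The matrix product is the Gram matrix, in the standard basis, of the symplectic form pulled back
  along the derivative. This turns a matrix identity into a coordinate-free one for the form.
\<close>

lemma pullback_J_mat_component:
  fixes F :: "(real^'n) \<times> (real^'n) \<Rightarrow> (real^'n) \<times> (real^'n)"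
  assumes "(F has_derivative F') (at z)"
  shows "(transpose (jacobian_at F z) ** J_mat ** jacobian_at F z) $ i $ j
    = symplectic_form (F' (unpack (axis i 1))) (F' (unpack (axis j 1)))"
proof -
  define P where "P = jacobian_at F z"
  have "(transpose P ** J_mat ** P) $ i $ j = axis i 1 \<bullet> ((transpose P ** J_mat ** P) *v axis j 1)"
    by (simp add: matrix_vector_mult_basis column_def inner_axis')
  also have "\<dots> = axis i 1 \<bullet> (transpose P *v (J_mat *v (P *v axis j 1)))"
    by (simp only: matrix_vector_mul_assoc matrix_mul_assoc)
  also have "\<dots> = (P *v axis i 1) \<bullet> (J_mat *v (P *v axis j 1))"
    by (rule dot_lmul_matrix[of _ "transpose P", unfolded vector_transpose_matrix, symmetric])
  finally show ?thesis
    unfolding P_def jacobian_at_mult[OF assms] inner_pack_J_mat_pack .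
qed

lemma norm_matrix_le:
  fixes X :: "real^'n^'m"
  assumes "\<And>i j. \<bar>X $ i $ j\<bar> \<le> c"
  shows "norm X \<le> real CARD('m) * real CARD('n) * c"
proof -
  have "norm X \<le> (\<Sum>i\<in>UNIV. norm (X $ i))"
    unfolding norm_vec_def by (rule L2_set_le_sum) simp
  also have "\<dots> \<le> (\<Sum>i\<in>(UNIV :: 'm set). \<Sum>j\<in>(UNIV :: 'n set). c)"
    using assms by (intro sum_mono order_trans[OF norm_le_l1_cart]) auto
  finally show ?thesis
    by simp
qed

section \<open>Order of the deviation from symplecticity\<close>

theorem corollary5:
  fixes H :: "(real^'n) \<times> (real^'n) \<Rightarrow> real"
    and \<D> U :: "((real^'n) \<times> (real^'n)) set"
    and M :: nat
  assumes "compact \<D>" and "convex \<D>"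
    and "open U" and "\<D> \<subseteq> U" and "smooth_on U H"
    and "M \<ge> 1"
  shows "\<exists>C. \<forall>S h0. admissible H \<D> M S h0 \<longrightarrow>
    (\<exists>E D :: real \<Rightarrow> (real^'n) \<times> (real^'n) \<Rightarrow> real^'n^'n.
       (\<forall>h z. 0 < h \<and> h \<le> h0 \<and> z \<in> S \<longrightarrow>
          num_flow H M h differentiable (at z) \<and>
          transpose (jacobian_at (num_flow H M h) z) ** J_mat ** jacobian_at (num_flow H M h) z
            = block_mat 0 (mat 1 + E h z) (- transpose (mat 1 + E h z)) (D h z) \<and>
          block_mat 0 (mat 1 + E h z) (- transpose (mat 1 + E h z)) (D h z)
            = J_mat + block_mat 0 (E h z) (- transpose (E h z)) (D h z)) \<and>
       (\<forall>\<^sub>F h in at_right 0. \<forall>z\<in>S. norm (E h z) \<le> C * h ^ (M + 1)) \<and>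
       (\<forall>\<^sub>F h in at_right 0. \<forall>z\<in>S. norm (D h z) \<le> C * h ^ (M + 1)))"
proof -
  obtain G A K where G [rule_format]: "\<forall>z\<in>U. GDERIV H z :> G z"
    and A [rule_format]: "\<forall>z\<in>U. (G has_derivative A z) (at z)"
    and A_sym [rule_format]: "\<forall>z\<in>U. \<forall>v w. A z v \<bullet> w = A z w \<bullet> v"
    and K: "K \<ge> 0"
    and G_bound [rule_format]: "\<forall>z\<in>\<D>. norm (G z) \<le> K"
    and G_Lipschitz [rule_format]: "\<forall>y\<in>\<D>. \<forall>z\<in>\<D>. norm (G y - G z) \<le> K * norm (y - z)"
    and A_bound [rule_format]: "\<forall>z\<in>\<D>. \<forall>w. norm (A z w) \<le> K * norm w"
    and A_Lipschitz [rule_format]: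
      "\<forall>y\<in>\<D>. \<forall>z\<in>\<D>. \<forall>w. norm (A y w - A z w) \<le> K * norm (y - z) * norm w"
    by (rule smooth_on_gradient_Hessian[OF \<open>smooth_on U H\<close> \<open>open U\<close> \<open>compact \<D>\<close> \<open>convex \<D>\<close> \<open>\<D> \<subseteq> U\<close>])
  have grad_p: "grad_p H z = snd (G z)" if "z \<in> \<D>" for z
    using partial_gradients(2)[OF G] that \<open>\<D> \<subseteq> U\<close> by blast
  define \<delta> where "\<delta> h z w = tangent_iter A H h z M w - tangent_iter A H h z (Suc M) w" for h z w
  obtain c where c: "c \<ge> 0" and \<delta>_bound:
    "\<And>h z w. 0 < h \<Longrightarrow> h \<le> 1 \<Longrightarrow> \<forall>n\<le>M. (fp_iter H h (fst z) (snd z) n, snd z) \<in> \<D> \<Longrightarrow>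
      norm (\<delta> h z w) \<le> c * h ^ (M + 1) * norm w"
  proof -
    have "\<exists>C\<ge>0. \<forall>h z w. 0 < h \<and> h \<le> 1 \<and>
        (\<forall>n\<le>M. (fp_iter H h (fst z) (snd z) n, snd z) \<in> \<D>) \<longrightarrow>
      norm (tangent_iter A H h z (Suc M) w - tangent_iter A H h z M w) \<le> C * h ^ Suc M * norm w"
    proof (rule tangent_iter_difference_bound[OF K _ _ _ A_bound A_Lipschitz])
      show "norm (grad_p H z) \<le> K" if "z \<in> \<D>" for z
        unfolding grad_p[OF that] using norm_component_le(2) G_bound[OF that] by (rule order_trans)
      show "norm (grad_p H y - grad_p H z) \<le> K * norm (y - z)" if "y \<in> \<D>" "z \<in> \<D>" for y z
        using order_trans[OF norm_component_le(2) G_Lipschitz[OF that]] by (simp add: grad_p that)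
      show "linear (A z)" if "z \<in> \<D>" for z
        using A that \<open>\<D> \<subseteq> U\<close> by (blast intro: has_derivative_linear)
    qed
    then show thesis
      using that unfolding \<delta>_def by (metis Suc_eq_plus1 norm_minus_commute)
  qed
  \<comment> \<open>Row \<open>a\<close>, column \<open>b\<close> are read off from the defect identity with \<open>v\<close> the \<open>a\<close>-th and \<open>w\<close> the \<open>b\<close>-th basis
      vector of the block: \<open>v = (e\<^sub>a, 0)\<close>, \<open>w = (0, e\<^sub>b)\<close> for \<open>E\<close>, and \<open>v = (0, e\<^sub>a)\<close>, \<open>w = (0, e\<^sub>b)\<close> for \<open>D\<close>.\<close>
  define E where "E h z = (\<chi> a b. \<delta> h z (axis a 1, 0) $ b)" for h z
  define D where "D h z = (\<chi> a b. \<delta> h z (0, axis a 1) $ b - \<delta> h z (0, axis b 1) $ a)" for h z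
  \<comment> \<open>One factor per matrix index; the factor 2 accounts for the two terms in an entry of \<open>D\<close>.\<close>
  define C where "C = real CARD('n) * real CARD('n) * (2 * c)"
  have bounds: "norm (E h z) \<le> C * h ^ (M + 1)" "norm (D h z) \<le> C * h ^ (M + 1)"
    if h: "0 < h" "h \<le> 1" and in_D: "\<forall>n\<le>M. (fp_iter H h (fst z) (snd z) n, snd z) \<in> \<D>" for h z
  proof -
    have component: "\<bar>\<delta> h z w $ b\<bar> \<le> c * h ^ (M + 1)" if "norm w = 1" for w b
      using order_trans[OF component_le_norm_cart \<delta>_bound[OF h in_D, of w]] that by simp
    have "\<bar>E h z $ a $ b\<bar> \<le> 2 * c * h ^ (M + 1)" for a b
    proof -
      have "\<bar>E h z $ a $ b\<bar> \<le> c * h ^ (M + 1)"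
        unfolding E_def using component[of "(axis a 1, 0)" b] by (simp add: norm_Pair)
      also have "\<dots> \<le> 2 * c * h ^ (M + 1)"
        using c h by (intro mult_right_mono) auto
      finally show ?thesis .
    qed
    then show "norm (E h z) \<le> C * h ^ (M + 1)"
      using norm_matrix_le[of "E h z" "2 * c * h ^ (M + 1)"] by (simp add: C_def mult_ac)
    have "\<bar>D h z $ a $ b\<bar> \<le> 2 * c * h ^ (M + 1)" for a b
      unfolding D_def using component[of "(0, axis a 1)" b] component[of "(0, axis b 1)" a]
      by (simp add: norm_Pair)
    then show "norm (D h z) \<le> C * h ^ (M + 1)"
      using norm_matrix_le[of "D h z" "2 * c * h ^ (M + 1)"] by (simp add: C_def mult_ac)
  qed
  have flow: "num_flow H M h differentiable (at z)"
    "transpose (jacobian_at (num_flow H M h) z) ** J_mat ** jacobian_at (num_flow H M h) z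
      = block_mat 0 (mat 1 + E h z) (- transpose (mat 1 + E h z)) (D h z)"
    if in_D: "\<forall>n\<le>M. (fp_iter H h (fst z) (snd z) n, snd z) \<in> \<D>" for h z
  proof -
    define y where "y = (fp_iter H h (fst z) (snd z) M, snd z)"
    define t where "t w = tangent_iter A H h z M w" for w
    define \<Psi>' where "\<Psi>' w = (t w, snd w - h *\<^sub>R fst (A y (t w, snd w)))" for w
    have in_U: "(fp_iter H h (fst z) (snd z) n, snd z) \<in> U" if "n \<le> M" for n
      using in_D that \<open>\<D> \<subseteq> U\<close> by blast
    have d: "(num_flow H M h has_derivative \<Psi>') (at z)"
      unfolding \<Psi>'_def[abs_def] t_def y_def
      using num_flow_has_derivative[OF \<open>open U\<close> G A in_U] .
    then show "num_flow H M h differentiable (at z)"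
      by (rule differentiableI)
    have form: "symplectic_form (\<Psi>' v) (\<Psi>' w)
        = symplectic_form v w + \<delta> h z v \<bullet> snd w - snd v \<bullet> \<delta> h z w" for v w
      unfolding \<Psi>'_def
      by (rule symplectic_form_derivative_step)
        (use A_sym[OF in_U[OF order_refl]] in \<open>simp_all add: \<delta>_def t_def y_def\<close>)
    have axis_nth_eq: "(axis a 1 :: real^'n) $ b = (if a = b then 1 else 0)" for a b
      by (simp add: axis_def)
    have "(transpose (jacobian_at (num_flow H M h) z) ** J_mat ** jacobian_at (num_flow H M h) z) $ i $ j
        = block_mat 0 (mat 1 + E h z) (- transpose (mat 1 + E h z)) (D h z) $ i $ j" for i j
      unfolding pullback_J_mat_component[OF d] form
      by (cases i; cases j)
        (auto simp: unpack_axis symplectic_form_def block_mat_def E_def D_def mat_def transpose_def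
          inner_axis inner_axis' axis_nth_eq)
    then show "transpose (jacobian_at (num_flow H M h) z) ** J_mat ** jacobian_at (num_flow H M h) z
        = block_mat 0 (mat 1 + E h z) (- transpose (mat 1 + E h z)) (D h z)"
      by (simp add: vec_eq_iff)
  qed
  have split: "block_mat 0 (mat 1 + E h z) (- transpose (mat 1 + E h z)) (D h z)
      = J_mat + block_mat 0 (E h z) (- transpose (E h z)) (D h z)" for h z
    by (auto simp: J_mat_def block_mat_def vec_eq_iff transpose_def mat_def split: sum.split)
  show ?thesis
  proof (intro exI[of _ C] allI impI)
    fix S h0
    assume "admissible H \<D> M S h0"
    then have h0: "h0 > 0" and in_D: "\<And>h z. 0 < h \<Longrightarrow> h \<le> h0 \<Longrightarrow> z \<in> S \<Longrightarrow>
        \<forall>n\<le>M. (fp_iter H h (fst z) (snd z) n, snd z) \<in> \<D>"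
      unfolding admissible_def by (auto simp del: split_paired_All)
    \<comment> \<open>The constant is valid for \<open>h \<le> 1\<close>, so \<open>h0\<close> only limits how small \<open>h\<close> has to be.\<close>
    have small: "\<forall>\<^sub>F h in at_right 0. 0 < h \<and> h \<le> 1 \<and> h \<le> h0"
      by (rule eventually_at_rightI[of 0 "min 1 h0"]) (use h0 in auto)
    show "\<exists>E D. (\<forall>h z. 0 < h \<and> h \<le> h0 \<and> z \<in> S \<longrightarrow>
          num_flow H M h differentiable (at z) \<and>
          transpose (jacobian_at (num_flow H M h) z) ** J_mat ** jacobian_at (num_flow H M h) z
            = block_mat 0 (mat 1 + E h z) (- transpose (mat 1 + E h z)) (D h z) \<and>
          block_mat 0 (mat 1 + E h z) (- transpose (mat 1 + E h z)) (D h z)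
            = J_mat + block_mat 0 (E h z) (- transpose (E h z)) (D h z)) \<and>
       (\<forall>\<^sub>F h in at_right 0. \<forall>z\<in>S. norm (E h z) \<le> C * h ^ (M + 1)) \<and>
       (\<forall>\<^sub>F h in at_right 0. \<forall>z\<in>S. norm (D h z) \<le> C * h ^ (M + 1))"
    proof (rule exI[of _ E], rule exI[of _ D], intro conjI allI impI)
      show "\<forall>\<^sub>F h in at_right 0. \<forall>z\<in>S. norm (E h z) \<le> C * h ^ (M + 1)"
        using small by eventually_elim (intro ballI bounds in_D; simp)
      show "\<forall>\<^sub>F h in at_right 0. \<forall>z\<in>S. norm (D h z) \<le> C * h ^ (M + 1)"
        using small by eventually_elim (intro ballI bounds in_D; simp)
    qed (use flow split in_D in blast)+
  qed
qed

end
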